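(* Let $\omega^{ij}=\{z^i,z^j\}$ be a nondegenerate Poisson tensor on $\mathbb{M}_n$, and let $\Phi^\alpha(z)$, $\alpha=1,\dots,n-k$, be functionally independent functions such that the matrix $\triangle^{\alpha\beta}=\{\Phi^\alpha,\Phi^\beta\}$ satisfies $\det\triangle^{\alpha\beta}\ne0$ on $\mathbb{N}_k=\{\Phi^\alpha=0\}$. Let $\tilde\triangle_{\alpha\beta}$ be the inverse matrix of $\triangle^{\alpha\beta}$, and let $z^\alpha=f^\alpha(z^c)$ be the parametric equations of $\mathbb{N}_k$, with $z^i=(z^\alpha,z^a)$. Then the matrix $$\omega_{\mathbf f}^{ab}(z^c)=\left.\left(\{z^a,z^b\}-\{z^a,\Phi^\alpha\}\,\tilde\triangle_{\alpha\beta}\,\{\Phi^\beta,z^b\}\right)\right|_{z^\alpha=f^\alpha(z^c)}$$ satisfies the Jacobi identity $\omega_{\mathbf f}^{ad}\partial_d\omega_{\mathbf f}^{bc}+\mathrm{cycle}(a,b,c)=0$, and determines a nondegenerate Poisson bracket on $\mathbb{N}_k$, $$\{A,B\}_{D(\mathbb{N})}=\partial_aA\,\omega_{\mathbf f}^{ab}\,\partial_bB .$$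
   Context: All objects are smooth, and all statements are local. Repeated indices are summed; $\mathrm{cycle}$ denotes the two remaining cyclic permutations. A Poisson tensor on a manifold with coordinates $z^i$ is a contravariant tensor $\omega^{ij}(z)$ with $\omega^{ij}=-\omega^{ji}$ and $\omega^{ip}\partial_p\omega^{jk}+\mathrm{cycle}(i,j,k)=0$; its Poisson bracket is $\{A,B\}=\partial_iA\,\omega^{ij}\,\partial_jB$, and it is nondegenerate if $\det\omega\neq0$. Functions $\Phi^\alpha$ are functionally independent if $\operatorname{rank}(\partial_i\Phi^\alpha)=n-k$; coordinates are then grouped as $z^i=(z^\alpha,z^a)$, $a=1,\dots,k$, with $\det(\partial\Phi^\alpha/\partial z^\beta)\ne0$, so that $\Phi^\alpha=0$ can be solved as $z^\alpha=f^\alpha(z^a)$ and $z^a$ are local coordinates on $\mathbb{N}_k$. *)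

theory Defs
  imports "HOL-Analysis.Analysis"
begin

definition partial :: "'n::finite \<Rightarrow> (real^'n \<Rightarrow> real) \<Rightarrow> real^'n \<Rightarrow> real" where
  "partial i A z = frechet_derivative A (at z) (axis i 1)"

primrec partials :: "'n::finite list \<Rightarrow> (real^'n \<Rightarrow> real) \<Rightarrow> real^'n \<Rightarrow> real" where
  "partials [] A = A"
| "partials (i # is) A = partial i (partials is A)"

text \<open>Meant for open \<open>U\<close>: \<open>A\<close> is \<open>C\<^sup>\<infinity>\<close> iff all its iterated partial derivatives exist and are
  (totally) differentiable, hence continuous.\<close>

definition smooth_on :: "(real^'n::finite) set \<Rightarrow> (real^'n \<Rightarrow> real) \<Rightarrow> bool" where
  "smooth_on U A \<longleftrightarrow> (\<forall>is. \<forall>z\<in>U. partials is A differentiable (at z))"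

definition jacobi_identity_on :: "(real^'n::finite) set \<Rightarrow> (real^'n \<Rightarrow> real^'n^'n) \<Rightarrow> bool" where
  "jacobi_identity_on U \<omega> \<longleftrightarrow> (\<forall>z\<in>U. \<forall>i j k.
      (\<Sum>p\<in>UNIV. \<omega> z $ i $ p * partial p (\<lambda>x. \<omega> x $ j $ k) z)
    + (\<Sum>p\<in>UNIV. \<omega> z $ j $ p * partial p (\<lambda>x. \<omega> x $ k $ i) z)
    + (\<Sum>p\<in>UNIV. \<omega> z $ k $ p * partial p (\<lambda>x. \<omega> x $ i $ j) z) = 0)"

definition poisson_tensor_on :: "(real^'n::finite) set \<Rightarrow> (real^'n \<Rightarrow> real^'n^'n) \<Rightarrow> bool" where
  "poisson_tensor_on U \<omega> \<longleftrightarrow>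
     (\<forall>i j. smooth_on U (\<lambda>z. \<omega> z $ i $ j)) \<and>
     (\<forall>z\<in>U. \<forall>i j. \<omega> z $ i $ j = - \<omega> z $ j $ i) \<and>
     jacobi_identity_on U \<omega>"

definition nondegenerate_on :: "(real^'n::finite) set \<Rightarrow> (real^'n \<Rightarrow> real^'n^'n) \<Rightarrow> bool" where
  "nondegenerate_on U \<omega> \<longleftrightarrow> (\<forall>z\<in>U. det (\<omega> z) \<noteq> 0)"

definition bracket ::
  "(real^'n::finite \<Rightarrow> real^'n^'n) \<Rightarrow> (real^'n \<Rightarrow> real) \<Rightarrow> (real^'n \<Rightarrow> real) \<Rightarrow> real^'n \<Rightarrow> real" where
  "bracket \<omega> A B z = (\<Sum>i\<in>UNIV. \<Sum>j\<in>UNIV. partial i A z * \<omega> z $ i $ j * partial j B z)"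

text \<open>A Poisson bracket on the smooth functions of an open set: a Lie bracket that is a derivation
  in its second (hence, by antisymmetry, in each) argument.\<close>

definition poisson_bracket_on ::
  "(real^'n::finite) set \<Rightarrow> ((real^'n \<Rightarrow> real) \<Rightarrow> (real^'n \<Rightarrow> real) \<Rightarrow> real^'n \<Rightarrow> real) \<Rightarrow> bool" where
  "poisson_bracket_on U br \<longleftrightarrow>
     (\<forall>A B. smooth_on U A \<longrightarrow> smooth_on U B \<longrightarrow>
        smooth_on U (br A B) \<and> (\<forall>z\<in>U. br A B z = - br B A z)) \<and>
     (\<forall>A B C. smooth_on U A \<longrightarrow> smooth_on U B \<longrightarrow> smooth_on U C \<longrightarrow> (\<forall>z\<in>U.
        (\<forall>s t. br A (\<lambda>x. s * B x + t * C x) z = s * br A B z + t * br A C z) \<and>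
        br A (\<lambda>x. B x * C x) z = br A B z * C z + B z * br A C z \<and>
        br A (br B C) z + br B (br C A) z + br C (br A B) z = 0))"

text \<open>Coordinates on the ambient space are indexed by the sum type \<open>'m + 'k\<close>: \<open>Inl \<alpha>\<close> labels
  \<open>z\<^sup>\<alpha>\<close> and \<open>Inr a\<close> labels \<open>z\<^sup>a\<close>, so \<open>CARD('m) = n - k\<close> and \<open>CARD('k) = k\<close>.\<close>

definition join :: "real^'m::finite \<Rightarrow> real^'k::finite \<Rightarrow> real^('m + 'k)" where
  "join x y = (\<chi> i. case i of Inl \<alpha> \<Rightarrow> x $ \<alpha> | Inr a \<Rightarrow> y $ a)"

definition constraint_set ::
  "(real^'n::finite) set \<Rightarrow> ('m::finite \<Rightarrow> real^'n \<Rightarrow> real) \<Rightarrow> (real^'n) set" where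
  "constraint_set U \<Phi> = {z \<in> U. \<forall>\<alpha>. \<Phi> \<alpha> z = 0}"

definition constraint_jacobian :: "('m::finite \<Rightarrow> real^'n::finite \<Rightarrow> real) \<Rightarrow> real^'n \<Rightarrow> real^'n^'m" where
  "constraint_jacobian \<Phi> z = (\<chi> \<alpha> i. partial i (\<Phi> \<alpha>) z)"

definition constraint_jacobian_left ::
  "('m::finite \<Rightarrow> real^('m + 'k::finite) \<Rightarrow> real) \<Rightarrow> real^('m + 'k) \<Rightarrow> real^'m^'m" where
  "constraint_jacobian_left \<Phi> z = (\<chi> \<alpha> \<beta>. partial (Inl \<beta>) (\<Phi> \<alpha>) z)"

definition constraint_matrix ::
  "(real^'n::finite \<Rightarrow> real^'n^'n) \<Rightarrow> ('m::finite \<Rightarrow> real^'n \<Rightarrow> real) \<Rightarrow> real^'n \<Rightarrow> real^'m^'m" where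
  "constraint_matrix \<omega> \<Phi> z = (\<chi> \<alpha> \<beta>. bracket \<omega> (\<Phi> \<alpha>) (\<Phi> \<beta>) z)"

definition dirac_matrix ::
  "(real^('m::finite + 'k::finite) \<Rightarrow> real^('m + 'k)^('m + 'k)) \<Rightarrow>
   ('m \<Rightarrow> real^('m + 'k) \<Rightarrow> real) \<Rightarrow> real^('m + 'k) \<Rightarrow> real^'k^'k" where
  "dirac_matrix \<omega> \<Phi> z = (\<chi> a b.
     bracket \<omega> (\<lambda>x. x $ Inr a) (\<lambda>x. x $ Inr b) z
     - (\<Sum>\<alpha>\<in>UNIV. \<Sum>\<beta>\<in>UNIV. bracket \<omega> (\<lambda>x. x $ Inr a) (\<Phi> \<alpha>) z
          * matrix_inv (constraint_matrix \<omega> \<Phi> z) $ \<alpha> $ \<beta>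
          * bracket \<omega> (\<Phi> \<beta>) (\<lambda>x. x $ Inr b) z))"

definition restricted_dirac_matrix ::
  "(real^('m::finite + 'k::finite) \<Rightarrow> real^('m + 'k)^('m + 'k)) \<Rightarrow>
   ('m \<Rightarrow> real^('m + 'k) \<Rightarrow> real) \<Rightarrow> (real^'k \<Rightarrow> real^'m) \<Rightarrow> real^'k \<Rightarrow> real^'k^'k" where
  "restricted_dirac_matrix \<omega> \<Phi> f y = dirac_matrix \<omega> \<Phi> (join (f y) y)"

end

theory Submission
  imports Defs
begin

text \<open>
  For an invertible antisymmetric matrix field \<open>\<omega>\<close> with inverse \<open>\<Omega>\<close>, the Jacobi identity for \<open>\<omega>\<close> is
  equivalent to closedness of the two-form \<open>\<Omega>\<close>. Let \<open>F y = join (f y) y\<close> be the parametrization of the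
  constraint surface and \<open>J\<close> its Jacobian matrix. Because the rows of the Dirac tensor are tangent to
  the surface, the restricted Dirac matrix turns out to be the inverse of the pullback
  \<open>J\<^sup>T \<Omega> J\<close>. A pullback of a closed form is closed, so the Jacobi identity holds on the surface;
  nondegeneracy, antisymmetry and (by Cramer's rule) smoothness are inherited from the same inverse.
\<close>

subsection \<open>Partial derivatives\<close>

lemma partial_eqI:
  assumes "(A has_derivative A') (at z)"
  shows "partial i A z = A' (axis i 1)"
  using frechet_derivative_at[OF assms] by (simp add: partial_def)

lemma partial_cong:
  assumes "open U" "z \<in> U" "\<And>x. x \<in> U \<Longrightarrow> A x = B x"
  shows "partial i A z = partial i B z"
proof -
  \<comment> \<open>\<open>frechet_derivative\<close> is a choice among all derivatives. Functions
    agreeing near \<open>z\<close> have the same derivatives, hence the same choice, even where they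
    are not differentiable.\<close>
  have "(A has_derivative D) (at z) \<longleftrightarrow> (B has_derivative D) (at z)" for D
    using has_derivative_transform_within_open[of _ _ z UNIV U]  assms by metis
  then show ?thesis by (simp add: partial_def frechet_derivative_def)
qed

lemma differentiable_cong_open:
  assumes "open U" "z \<in> U" "\<And>x. x \<in> U \<Longrightarrow> A x = B x" "A differentiable (at z)"
  shows "B differentiable (at z)"
  using has_derivative_transform_within_open[of _ _ z UNIV U]  assms unfolding differentiable_def by metis

lemma partial_const [simp]: "partial i (\<lambda>x. c) z = 0"
  by (simp add: partial_def)

lemma partial_coordinate: "partial i (\<lambda>x. x $ j) z = (if i = j then 1 else 0)"
  using partial_eqI[OF bounded_linear.has_derivative[OF bounded_linear_vec_nth has_derivative_ident], of i j z]
  by (auto simp: axis_def)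

lemma partial_add:
  assumes "A differentiable (at z)" "B differentiable (at z)"
  shows "partial i (\<lambda>x. A x + B x) z = partial i A z + partial i B z"
  using partial_eqI[OF has_derivative_add[OF assms[unfolded frechet_derivative_works]]]
  by (simp add: partial_def)

lemma partial_mult:
  assumes "A differentiable (at z)" "B differentiable (at z)"
  shows "partial i (\<lambda>x. A x * B x) z = partial i A z * B z + A z * partial i B z"
  using partial_eqI[OF has_derivative_mult[OF assms[unfolded frechet_derivative_works]]]
  by (simp add: partial_def)

lemma partial_cmult:
  assumes "A differentiable (at z)"
  shows "partial i (\<lambda>x. c * A x) z = c * partial i A z"
  using partial_mult[OF _ assms, of "\<lambda>x. c"] by simp

lemma partial_sum:
  assumes "\<And>l. l \<in> L \<Longrightarrow> A l differentiable (at z)"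
  shows "partial i (\<lambda>x. \<Sum>l\<in>L. A l x) z = (\<Sum>l\<in>L. partial i (A l) z)"
proof -
  have "((\<lambda>x. \<Sum>l\<in>L. A l x) has_derivative (\<lambda>v. \<Sum>l\<in>L. frechet_derivative (A l) (at z) v)) (at z)"
    using assms by (intro has_derivative_sum) (simp add: frechet_derivative_works[symmetric])
  from partial_eqI[OF this] show ?thesis by (simp add: partial_def)
qed

lemma partial_inverse:
  fixes A :: "real^'n::finite \<Rightarrow> real"
  assumes "A differentiable (at z)" "A z \<noteq> 0"
  shows "partial i (\<lambda>x. inverse (A x)) z = (- partial i A z) * (inverse (A z) * inverse (A z))"
  using partial_eqI[OF Deriv.has_derivative_inverse[OF assms(2) assms(1)[unfolded frechet_derivative_works]]]
  by (simp add: partial_def)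

section \<open>The chain rule in coordinates\<close>

lemma frechet_derivative_eq_partials:
  fixes A :: "real^'n::finite \<Rightarrow> real"
  assumes "A differentiable (at z)"
  shows "frechet_derivative A (at z) v = (\<Sum>i\<in>UNIV. partial i A z * v $ i)"
proof -
  interpret linear "frechet_derivative A (at z)"
    using assms by (rule linear_frechet_derivative)
  have "frechet_derivative A (at z) v = frechet_derivative A (at z) (\<Sum>i\<in>UNIV. v $ i *\<^sub>R axis i 1)"
    using basis_expansion[of v] by (simp add: scalar_mult_eq_scaleR)
  also have "\<dots> = (\<Sum>i\<in>UNIV. partial i A z * v $ i)"
    by (simp add: sum scale partial_def mult.commute)
  finally show ?thesis .
qed

text \<open>Smoothness is defined for scalar functions only, so vector-valued maps are handled
  through their components.\<close>

lemma differentiable_vec_componentwise: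
  fixes F :: "real^'n::finite \<Rightarrow> real^'m::finite"
  assumes "\<And>i. (\<lambda>x. F x $ i) differentiable (at y)"
  shows "(F has_derivative (\<lambda>v. \<chi> i. frechet_derivative (\<lambda>x. F x $ i) (at y) v)) (at y)"
  unfolding has_derivative_componentwise_within[where f = F]
  using assms by (auto simp: Basis_vec_def inner_axis frechet_derivative_works)

lemma partial_compose:
  fixes F :: "real^'n::finite \<Rightarrow> real^'m::finite"
  assumes "A differentiable (at (F y))" "\<And>i. (\<lambda>x. F x $ i) differentiable (at y)"
  shows "partial a (\<lambda>x. A (F x)) y = (\<Sum>i\<in>UNIV. partial i A (F y) * partial a (\<lambda>x. F x $ i) y)"
proof -
  note F' = differentiable_vec_componentwise[OF assms(2)]
  have A': "(A has_derivative frechet_derivative A (at (F y))) (at (F y))"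
    using assms(1) by (simp add: frechet_derivative_works)
  from partial_eqI[OF has_derivative_compose[OF F' A']] show ?thesis
    by (simp add: frechet_derivative_eq_partials[OF assms(1)]) (simp add: partial_def)
qed

lemma differentiable_compose_vec:
  fixes F :: "real^'n::finite \<Rightarrow> real^'m::finite"
  assumes "A differentiable (at (F y))" "\<And>i. (\<lambda>x. F x $ i) differentiable (at y)"
  shows "(\<lambda>x. A (F x)) differentiable (at y)"
  using has_derivative_compose[OF differentiable_vec_componentwise[OF assms(2)]] assms(1)
  unfolding differentiable_def by blast

subsection \<open>Smooth functions\<close>

text \<open>Induction on the order of differentiability replaces coinduction on \<open>smooth_on\<close>.\<close>
primrec times_differentiable_on :: "nat \<Rightarrow> (real^'n::finite) set \<Rightarrow> (real^'n \<Rightarrow> real) \<Rightarrow> bool" where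
  "times_differentiable_on 0 U A \<longleftrightarrow> True"
| "times_differentiable_on (Suc n) U A \<longleftrightarrow>
     (\<forall>z\<in>U. A differentiable (at z)) \<and> (\<forall>i. times_differentiable_on n U (partial i A))"

lemma partials_snoc: "partials (is @ [i]) A = partials is (partial i A)"
  by (induction "is") auto

text \<open>\<open>partials\<close> adds derivatives on the outside, the recursion of
  \<open>times_differentiable_on\<close> on the inside. Splitting a nonempty index list at its last
  entry, with \<open>partials_snoc\<close>, reconciles the two.\<close>

lemma times_differentiable_on_iff:
  "times_differentiable_on n U A \<longleftrightarrow>
     (\<forall>is. length is < n \<longrightarrow> (\<forall>z\<in>U. partials is A differentiable (at z)))"
proof (induction n arbitrary: A)
  case (Suc n)
  have *: "(\<forall>is. length is < Suc n \<longrightarrow> P is) \<longleftrightarrow> P [] \<and> (\<forall>i is. length is < n \<longrightarrow> P (is @ [i]))"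
    for P :: "'a list \<Rightarrow> bool"
  proof (intro iffI allI impI)
    fix xs :: "'a list"
    assume "P [] \<and> (\<forall>i is. length is < n \<longrightarrow> P (is @ [i]))" "length xs < Suc n"
    then show "P xs" by (cases xs rule: rev_cases) auto
  qed auto
  show ?case
    by (simp only: times_differentiable_on.simps Suc.IH * partials_snoc partials.simps)
qed simp

lemma smooth_on_iff: "smooth_on U A \<longleftrightarrow> (\<forall>n. times_differentiable_on n U A)"
  unfolding times_differentiable_on_iff smooth_on_def by (meson lessI)

lemma times_differentiable_on_SucD:
  "times_differentiable_on (Suc n) U A \<Longrightarrow> times_differentiable_on n U A"
  unfolding times_differentiable_on_iff by simp

lemma smooth_on_differentiable: "smooth_on U A \<Longrightarrow> z \<in> U \<Longrightarrow> A differentiable (at z)"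
  unfolding smooth_on_def by (metis partials.simps(1))

lemma smooth_on_partial: "smooth_on U A \<Longrightarrow> smooth_on U (partial i A)"
  unfolding smooth_on_def by (metis partials_snoc)

text \<open>Lets the formulas for derivatives of sums, products, inverses and compositions, known
  only on \<open>U\<close>, replace the actual partial derivatives in the inductions below.\<close>

lemma times_differentiable_on_cong:
  assumes "open U" "\<And>x. x \<in> U \<Longrightarrow> A x = B x" "times_differentiable_on n U A"
  shows "times_differentiable_on n U B"
  using assms(2,3)
proof (induction n arbitrary: A B)
  case (Suc n)
  have "times_differentiable_on n U (partial i B)" for i
  proof (rule Suc.IH)
    show "partial i A x = partial i B x" if "x \<in> U" for x
      using Suc.prems by (intro partial_cong[OF assms(1) that])
  qed (use Suc.prems in simp)
  moreover have "B differentiable (at z)" if "z \<in> U" for z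
    by (rule differentiable_cong_open[OF assms(1) that, of A]) (use Suc.prems that in auto)
  ultimately show ?case by simp
qed simp

lemma smooth_on_cong:
  "open U \<Longrightarrow> (\<And>x. x \<in> U \<Longrightarrow> A x = B x) \<Longrightarrow> smooth_on U A \<Longrightarrow> smooth_on U B"
  unfolding smooth_on_iff using times_differentiable_on_cong by metis

lemma times_differentiable_on_const:
  fixes U :: "(real^'n::finite) set"
  shows "times_differentiable_on n U (\<lambda>x. c)"
proof (induction n arbitrary: c)
  case (Suc n)
  have "partial i (\<lambda>x::real^'n. c) = (\<lambda>x. 0)" for i by (rule ext) simp
  then show ?case using Suc by simp
qed simp

lemma times_differentiable_on_add:
  assumes "open U"
  shows "times_differentiable_on n U A \<Longrightarrow> times_differentiable_on n U B \<Longrightarrow>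
    times_differentiable_on n U (\<lambda>x. A x + B x)"
proof (induction n arbitrary: A B)
  case (Suc n)
  have "times_differentiable_on n U (partial i (\<lambda>x. A x + B x))" for i
    by (rule times_differentiable_on_cong[OF assms, of "\<lambda>x. partial i A x + partial i B x"])
      (use Suc in \<open>auto simp: partial_add\<close>)
  then show ?case using Suc.prems by simp
qed simp

lemma times_differentiable_on_mult:
  assumes "open U"
  shows "times_differentiable_on n U A \<Longrightarrow> times_differentiable_on n U B \<Longrightarrow>
    times_differentiable_on n U (\<lambda>x. A x * B x)"
proof (induction n arbitrary: A B)
  case (Suc n)
  have "times_differentiable_on n U (partial i (\<lambda>x. A x * B x))" for i
  proof (rule times_differentiable_on_cong[OF assms, of "\<lambda>x. partial i A x * B x + A x * partial i B x"])
    show "times_differentiable_on n U (\<lambda>x. partial i A x * B x + A x * partial i B x)"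
      \<comment> \<open>The product rule also contains the undifferentiated factors, whose order
        must first be lowered to \<open>n\<close>.\<close>
      using Suc.prems[THEN times_differentiable_on_SucD] Suc.prems
      by (intro times_differentiable_on_add assms Suc.IH) auto
  qed (use Suc.prems in \<open>simp add: partial_mult\<close>)
  then show ?case using Suc.prems by simp
qed simp

lemma times_differentiable_on_sum:
  assumes "open U" "\<And>l. l \<in> L \<Longrightarrow> times_differentiable_on n U (A l)"
  shows "times_differentiable_on n U (\<lambda>x. \<Sum>l\<in>L. A l x)"
  \<comment> \<open>An infinite \<open>L\<close> is covered too, since its sum is 0 by
    convention.\<close>
  using assms(2) by (induction L rule: infinite_finite_induct)
    (auto intro: times_differentiable_on_add[OF assms(1)] times_differentiable_on_const)

lemma times_differentiable_on_inverse:
  fixes A :: "real^'n::finite \<Rightarrow> real"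
  assumes "open U" "\<And>x. x \<in> U \<Longrightarrow> A x \<noteq> 0"
  shows "times_differentiable_on n U A \<Longrightarrow> times_differentiable_on n U (\<lambda>x. inverse (A x))"
proof (induction n)
  case (Suc n)
  have *: "times_differentiable_on n U (\<lambda>x. inverse (A x))"
    using Suc.IH[OF times_differentiable_on_SucD[OF Suc.prems]] .
  have "times_differentiable_on n U (partial i (\<lambda>x. inverse (A x)))" for i
  \<comment> \<open>The derivative of 1/A contains 1/A itself, but only at order \<open>n\<close>,
    where the induction hypothesis applies. Writing the sign as a factor -1 leaves only products and
    constants to treat.\<close>
  proof (rule times_differentiable_on_cong[OF assms(1),
        of "\<lambda>x. (-1 * partial i A x) * (inverse (A x) * inverse (A x))"])
    show "times_differentiable_on n U (\<lambda>x. (-1 * partial i A x) * (inverse (A x) * inverse (A x)))"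
      using Suc.prems *
      by (intro times_differentiable_on_mult assms(1) times_differentiable_on_const) auto
  qed (use Suc.prems assms(2) in \<open>simp add: partial_inverse\<close>)
  then show ?case using Suc.prems assms(2) by (auto intro: differentiable_inverse)
qed simp

text \<open>The induction lowers the order of \<open>A\<close> alone: the chain rule produces
  \<open>partial i A\<close> composed with \<open>F\<close>, while the derivatives of the components
  of \<open>F\<close> remain smooth.\<close>

lemma times_differentiable_on_compose:
  fixes F :: "real^'n::finite \<Rightarrow> real^'m::finite"
  assumes "open V" "F ` V \<subseteq> U" "\<And>i. smooth_on V (\<lambda>y. F y $ i)"
  shows "times_differentiable_on n U A \<Longrightarrow> times_differentiable_on n V (\<lambda>y. A (F y))"
proof (induction n arbitrary: A)
  case (Suc n)
  have d: "A differentiable (at (F y))" "(\<lambda>y. F y $ i) differentiable (at y)" if "y \<in> V" for y i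
    using assms(2,3) Suc.prems that by (auto intro: smooth_on_differentiable)
  have "times_differentiable_on n V (partial a (\<lambda>y. A (F y)))" for a
  proof (rule times_differentiable_on_cong[OF assms(1),
        of "\<lambda>y. \<Sum>i\<in>UNIV. partial i A (F y) * partial a (\<lambda>y. F y $ i) y"])
    show "times_differentiable_on n V (\<lambda>y. \<Sum>i\<in>UNIV. partial i A (F y) * partial a (\<lambda>y. F y $ i) y)"
      using Suc.prems assms(3)[THEN smooth_on_partial]
      by (intro times_differentiable_on_sum times_differentiable_on_mult assms(1) Suc.IH)
        (auto simp: smooth_on_iff)
  qed (simp add: partial_compose d)
  then show ?case by (auto intro: differentiable_compose_vec d)
qed simp

section \<open>Closure properties of smooth functions\<close>

lemma smooth_on_const: "smooth_on U (\<lambda>x. c)"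
  by (simp add: smooth_on_iff times_differentiable_on_const)

lemma smooth_on_mult:
  "open U \<Longrightarrow> smooth_on U A \<Longrightarrow> smooth_on U B \<Longrightarrow> smooth_on U (\<lambda>x. A x * B x)"
  by (simp add: smooth_on_iff times_differentiable_on_mult)

lemma smooth_on_sum:
  "open U \<Longrightarrow> (\<And>l. l \<in> L \<Longrightarrow> smooth_on U (A l)) \<Longrightarrow> smooth_on U (\<lambda>x. \<Sum>l\<in>L. A l x)"
  by (simp add: smooth_on_iff times_differentiable_on_sum)

lemma smooth_on_prod:
  assumes "open U" "\<And>l. l \<in> L \<Longrightarrow> smooth_on U (A l)"
  shows "smooth_on U (\<lambda>x. \<Prod>l\<in>L. A l x)"
  using assms(2) by (induction L rule: infinite_finite_induct)
    (auto intro: smooth_on_mult[OF assms(1)] smooth_on_const)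

lemma smooth_on_divide:
  "open U \<Longrightarrow> smooth_on U A \<Longrightarrow> smooth_on U B \<Longrightarrow> (\<And>x. x \<in> U \<Longrightarrow> B x \<noteq> 0) \<Longrightarrow>
    smooth_on U (\<lambda>x. A x / B x)"
  unfolding divide_inverse
  by (simp add: smooth_on_iff times_differentiable_on_inverse times_differentiable_on_mult)

lemma smooth_on_compose:
  fixes F :: "real^'n::finite \<Rightarrow> real^'m::finite"
  shows "open V \<Longrightarrow> F ` V \<subseteq> U \<Longrightarrow> (\<And>i. smooth_on V (\<lambda>y. F y $ i)) \<Longrightarrow> smooth_on U A \<Longrightarrow>
    smooth_on V (\<lambda>y. A (F y))"
  unfolding smooth_on_iff[of U A] smooth_on_iff[of V "\<lambda>y. A (F y)"]
  using times_differentiable_on_compose by metis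

lemma smooth_on_coordinate:
  fixes U :: "(real^'n::finite) set"
  shows "smooth_on U (\<lambda>x. x $ j)"
proof -
  have "partial i (\<lambda>x::real^'n. x $ j) = (\<lambda>x. if i = j then 1 else 0)" for i
    by (rule ext) (simp add: partial_coordinate)
  moreover have "(\<lambda>x. x $ j) differentiable (at z)" for z :: "real^'n"
    by (intro bounded_linear_imp_differentiable bounded_linear_vec_nth)
  ultimately have "times_differentiable_on (Suc n) U (\<lambda>x. x $ j)" for n
    by (simp add: times_differentiable_on_const)
  then show ?thesis unfolding smooth_on_iff using times_differentiable_on_SucD by blast
qed

subsection \<open>Matrix-valued functions\<close>

lemma smooth_on_det:
  fixes A :: "real^'n::finite \<Rightarrow> real^'m^'m"
  assumes "open U" "\<And>i j. smooth_on U (\<lambda>x. A x $ i $ j)"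
  shows "smooth_on U (\<lambda>x. det (A x))"
  unfolding det_def
  by (intro smooth_on_sum smooth_on_mult smooth_on_prod smooth_on_const assms)

text \<open>\<open>matrix_inv\<close> is a Hilbert choice; a nonzero determinant guarantees that a
  matrix to choose exists.\<close>

lemma matrix_inv_right_left:
  fixes A :: "real^'n::finite^'n"
  assumes "det A \<noteq> 0"
  shows "A ** matrix_inv A = mat 1" "matrix_inv A ** A = mat 1"
  using someI_ex[OF assms[folded invertible_det_nz, unfolded invertible_def]]
  by (simp_all add: matrix_inv_def)

text \<open>Column \<open>l\<close> of the inverse solves A x = e_l, so Cramer's rule gives its
  entries as quotients of determinants. This form makes their smoothness evident.\<close>

lemma matrix_inv_cramer:
  fixes A :: "real^'n::finite^'n"
  assumes "det A \<noteq> 0"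
  shows "matrix_inv A $ k $ l =
    det (\<chi> i j. if j = k then (if i = l then 1 else 0) else A $ i $ j) / det A"
proof -
  have "A *v (matrix_inv A *v axis l 1) = axis l 1"
    using matrix_inv_right_left(1)[OF assms] by (simp add: matrix_vector_mul_assoc)
  from this[unfolded cramer[OF assms]] have
    "(matrix_inv A *v axis l 1) $ k =
      det (\<chi> i j. if j = k then axis l 1 $ i else A $ i $ j) / det A" by simp
  then show ?thesis by (simp add: matrix_vector_mult_basis column_def) (simp add: axis_def cong: if_cong)
qed

lemma smooth_on_matrix_inv:
  fixes A :: "real^'n::finite \<Rightarrow> real^'m::finite^'m"
  assumes "open U" "\<And>i j. smooth_on U (\<lambda>x. A x $ i $ j)" "\<And>x. x \<in> U \<Longrightarrow> det (A x) \<noteq> 0"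
  shows "smooth_on U (\<lambda>x. matrix_inv (A x) $ k $ l)"
proof (rule smooth_on_cong[OF assms(1)])
  let ?B = "\<lambda>x. \<chi> i j. if j = k then (if i = l then 1 else 0) else A x $ i $ j"
  have "smooth_on U (\<lambda>x. ?B x $ i $ j)" for i j
    by (cases "j = k") (simp_all add: smooth_on_const assms(2))
  then show "smooth_on U (\<lambda>x. det (?B x) / det (A x))"
    by (intro smooth_on_divide smooth_on_det assms)
qed (simp add: matrix_inv_cramer assms)

subsection \<open>Symmetry of second derivatives\<close>

lemma has_field_derivative_along_axis:
  assumes "A differentiable (at (p + t *\<^sub>R axis i 1))"
  shows "((\<lambda>t. A (p + t *\<^sub>R axis i 1)) has_field_derivative partial i A (p + t *\<^sub>R axis i 1)) (at t)"
proof -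
  interpret linear "frechet_derivative A (at (p + t *\<^sub>R axis i 1))"
    using assms by (rule linear_frechet_derivative)
  have 1: "((\<lambda>t. p + t *\<^sub>R axis i 1) has_derivative (\<lambda>s. s *\<^sub>R axis i 1)) (at t)"
    by (auto intro!: derivative_eq_intros)
  have "(A has_derivative frechet_derivative A (at (p + t *\<^sub>R axis i 1))) (at (p + t *\<^sub>R axis i 1))"
    using assms by (simp add: frechet_derivative_works)
  from has_derivative_compose[OF 1 this] show ?thesis
    by (simp add: has_field_derivative_def scale partial_def mult_commute_abs)
qed

text \<open>The mean value theorem is applied twice: to the difference of \<open>A\<close> along two
  parallel segments in direction \<open>i\<close>, then to \<open>partial i A\<close> in direction
  \<open>j\<close>.\<close>

lemma second_difference:
  assumes "0 < h" "cball z (2 * h) \<subseteq> U" "smooth_on U A"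
  shows "\<exists>p\<in>cball z (2 * h). A (z + h *\<^sub>R axis i 1 + h *\<^sub>R axis j 1) - A (z + h *\<^sub>R axis i 1)
    - A (z + h *\<^sub>R axis j 1) + A z = h\<^sup>2 * partial j (partial i A) p"
proof -
  \<comment> \<open>The displacement has norm at most \<open>s + t\<close>, which explains the
    radius \<open>2 * h\<close>; the bound also covers \<open>i = j\<close>.\<close>
  have in_ball: "z + s *\<^sub>R axis i 1 + t *\<^sub>R axis j 1 \<in> cball z (2 * h)"
    if "0 \<le> s" "s \<le> h" "0 \<le> t" "t \<le> h" for s t
  proof -
    have "norm (s *\<^sub>R axis i (1::real) + t *\<^sub>R axis j 1) \<le> s + t"
      by (rule order_trans[OF norm_triangle_ineq]) (use that in \<open>simp add: norm_axis_1\<close>)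
    moreover have "dist z (z + s *\<^sub>R axis i 1 + t *\<^sub>R axis j 1) = norm (s *\<^sub>R axis i (1::real) + t *\<^sub>R axis j 1)"
      unfolding dist_norm norm_minus_commute[of z] by (simp add: add.assoc)
    ultimately show ?thesis using that by simp
  qed
  have diff: "A differentiable (at p)" "partial i A differentiable (at p)" if "p \<in> cball z (2 * h)" for p
    using assms(2) that smooth_on_differentiable[OF assms(3)]
      smooth_on_differentiable[OF smooth_on_partial[OF assms(3)]] by blast+
  have 1: "((\<lambda>s. A (z + h *\<^sub>R axis j 1 + s *\<^sub>R axis i 1) - A (z + s *\<^sub>R axis i 1)) has_field_derivative
     partial i A (z + h *\<^sub>R axis j 1 + s *\<^sub>R axis i 1) - partial i A (z + s *\<^sub>R axis i 1)) (at s)"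
    if "0 \<le> s" "s \<le> h" for s
    using in_ball[OF that, of h] in_ball[OF that, of 0] assms(1)
    by (intro derivative_intros has_field_derivative_along_axis diff) (auto simp: add_ac)
  obtain s where s: "0 < s" "s < h" and
    eq1: "(A (z + h *\<^sub>R axis j 1 + h *\<^sub>R axis i 1) - A (z + h *\<^sub>R axis i 1))
       - (A (z + h *\<^sub>R axis j 1 + 0 *\<^sub>R axis i 1) - A (z + 0 *\<^sub>R axis i 1))
     = (h - 0) * (partial i A (z + h *\<^sub>R axis j 1 + s *\<^sub>R axis i 1) - partial i A (z + s *\<^sub>R axis i 1))"
    using MVT2[OF assms(1) 1] by auto
  have 2: "((\<lambda>t. partial i A (z + s *\<^sub>R axis i 1 + t *\<^sub>R axis j 1)) has_field_derivative
     partial j (partial i A) (z + s *\<^sub>R axis i 1 + t *\<^sub>R axis j 1)) (at t)" if "0 \<le> t" "t \<le> h" for t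
    using s that by (intro has_field_derivative_along_axis diff in_ball) auto
  obtain t where t: "0 < t" "t < h" and
    eq2: "partial i A (z + s *\<^sub>R axis i 1 + h *\<^sub>R axis j 1) - partial i A (z + s *\<^sub>R axis i 1 + 0 *\<^sub>R axis j 1)
      = (h - 0) * partial j (partial i A) (z + s *\<^sub>R axis i 1 + t *\<^sub>R axis j 1)"
    using MVT2[OF assms(1) 2] by auto
  from eq1 eq2 have "A (z + h *\<^sub>R axis i 1 + h *\<^sub>R axis j 1) - A (z + h *\<^sub>R axis i 1)
    - A (z + h *\<^sub>R axis j 1) + A z = h\<^sup>2 * partial j (partial i A) (z + s *\<^sub>R axis i 1 + t *\<^sub>R axis j 1)"
    by (simp add: power2_eq_square add_ac)
  then show ?thesis using in_ball[of s t] s t by (meson less_imp_le)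
qed

text \<open>The second difference is symmetric in \<open>i\<close> and \<open>j\<close>, so the two
  mixed derivatives agree at some points \<open>p\<close> and \<open>q\<close> arbitrarily close to
  \<open>z\<close>; continuity carries this to \<open>z\<close>.\<close>

lemma partial_partial_commute:
  assumes "open U" "z \<in> U" "smooth_on U A"
  shows "partial i (partial j A) z = partial j (partial i A) z"
proof (rule ccontr)
  let ?X = "partial i (partial j A)" and ?Y = "partial j (partial i A)"
  \<comment> \<open>With half the gap as tolerance, equal values at \<open>p\<close> and
    \<open>q\<close> would put the values at \<open>z\<close> closer together than their
    distance.\<close>
  define e where "e = \<bar>?X z - ?Y z\<bar> / 2"
  assume "?X z \<noteq> ?Y z"
  then have e: "e > 0" by (simp add: e_def)
  have cont: "isCont ?X z" "isCont ?Y z"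
    using assms by (auto intro!: differentiable_imp_continuous_within smooth_on_differentiable smooth_on_partial)
  obtain d1 where d1: "d1 > 0" "\<And>x. dist x z < d1 \<Longrightarrow> dist (?X x) (?X z) < e"
    using cont(1) e unfolding continuous_at_eps_delta by blast
  obtain d2 where d2: "d2 > 0" "\<And>x. dist x z < d2 \<Longrightarrow> dist (?Y x) (?Y z) < e"
    using cont(2) e unfolding continuous_at_eps_delta by blast
  obtain r where r: "r > 0" "cball z r \<subseteq> U"
    using assms(1,2) open_contains_cball by blast
  \<comment> \<open>Division by 3 keeps the radius \<open>2 * h\<close> strictly below both
    continuity radii and inside \<open>U\<close>.\<close>
  define h where "h = min r (min d1 d2) / 3"
  have h: "h > 0" "2 * h < d1" "2 * h < d2" "2 * h \<le> r" using d1 d2 r by (auto simp: h_def)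
  then have sub: "cball z (2 * h) \<subseteq> U" using r by (meson order_trans subset_cball)
  obtain p where p: "p \<in> cball z (2 * h)" "A (z + h *\<^sub>R axis i 1 + h *\<^sub>R axis j 1) - A (z + h *\<^sub>R axis i 1)
    - A (z + h *\<^sub>R axis j 1) + A z = h\<^sup>2 * ?Y p"
    using second_difference[OF h(1) sub assms(3)] by blast
  obtain q where q: "q \<in> cball z (2 * h)" "A (z + h *\<^sub>R axis j 1 + h *\<^sub>R axis i 1) - A (z + h *\<^sub>R axis j 1)
    - A (z + h *\<^sub>R axis i 1) + A z = h\<^sup>2 * ?X q"
    using second_difference[OF h(1) sub assms(3)] by blast
  have "h\<^sup>2 * ?Y p = h\<^sup>2 * ?X q" unfolding p(2)[symmetric] q(2)[symmetric] by (simp add: add_ac)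
  then have "?Y p = ?X q" using h by simp
  moreover have "dist (?Y p) (?Y z) < e" "dist (?X q) (?X z) < e"
    using p(1) q(1) h by (auto intro!: d1(2) d2(2) simp: dist_commute)
  ultimately show False by (simp add: e_def dist_real_def) argo
qed

subsection \<open>The Jacobi identity and closed two-forms\<close>

lemma sum_cycle:
  fixes g :: "'a::finite \<Rightarrow> 'a \<Rightarrow> 'a \<Rightarrow> real"
  shows "(\<Sum>p\<in>UNIV. \<Sum>q\<in>UNIV. \<Sum>r\<in>UNIV. g q r p) = (\<Sum>p\<in>UNIV. \<Sum>q\<in>UNIV. \<Sum>r\<in>UNIV. g p q r)"
  by (subst sum.swap, rule sum.cong[OF refl], rule sum.swap)

text \<open>Here \<open>dW\<close> and \<open>dO\<close> stand for the derivatives of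
  \<open>W\<close> and of its inverse, and the second assumption is the rule for differentiating an
  inverse. Antisymmetry turns \<open>W r k\<close> into \<open>- W k r\<close>, which absorbs the
  minus sign.\<close>

lemma jacobiator_eq_contraction:
  fixes W :: "'n::finite \<Rightarrow> 'n \<Rightarrow> real"
  assumes "\<And>j k. W j k = - W k j"
    and "\<And>p j k. dW p j k = - (\<Sum>q\<in>UNIV. \<Sum>r\<in>UNIV. W j q * dO p q r * W r k)"
  shows "(\<Sum>p\<in>UNIV. W i p * dW p j k) + (\<Sum>p\<in>UNIV. W j p * dW p k i) + (\<Sum>p\<in>UNIV. W k p * dW p i j)
    = (\<Sum>p\<in>UNIV. W i p * (\<Sum>q\<in>UNIV. W j q * (\<Sum>r\<in>UNIV. W k r * (dO p q r + dO q r p + dO r p q))))"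
proof -
  let ?g = "\<lambda>i j k p q r. W i p * W j q * W k r * dO p q r"
  have *: "(\<Sum>p\<in>UNIV. W i p * dW p j k) = (\<Sum>p\<in>UNIV. \<Sum>q\<in>UNIV. \<Sum>r\<in>UNIV. ?g i j k p q r)" for i j k
  proof -
    have "dW p j k = (\<Sum>q\<in>UNIV. \<Sum>r\<in>UNIV. W j q * (W k r * dO p q r))" for p
      unfolding assms(2) assms(1)[of _ k] by (simp add: sum_negf mult_ac)
    then show ?thesis by (simp add: sum_distrib_left mult_ac)
  qed
  \<comment> \<open>Cyclic renaming of the summation indices gives all three sums the common factor
    \<open>W i p * W j q * W k r\<close>.\<close>
  have 2: "(\<Sum>p\<in>UNIV. W j p * dW p k i) = (\<Sum>p\<in>UNIV. \<Sum>q\<in>UNIV. \<Sum>r\<in>UNIV. ?g j k i q r p)"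
    unfolding * by (rule sum_cycle[symmetric])
  have 3: "(\<Sum>p\<in>UNIV. W k p * dW p i j) = (\<Sum>p\<in>UNIV. \<Sum>q\<in>UNIV. \<Sum>r\<in>UNIV. ?g k i j r p q)"
    unfolding * using sum_cycle[of "\<lambda>p q r. ?g k i j r p q"] by simp
  show ?thesis unfolding *[of i j k] 2 3
    by (simp add: sum_distrib_left sum.distrib[symmetric] algebra_simps)
qed

lemma matrix_eq_zero_cancel:
  fixes W :: "real^'n::finite^'n"
  assumes "\<Omega> ** W = mat 1" "\<And>i. (\<Sum>p\<in>UNIV. W $ i $ p * x p) = 0"
  shows "x p = 0"
proof -
  have "W *v (\<chi> p. x p) = 0" using assms(2) by (simp add: vec_eq_iff matrix_vector_mult_def)
  then have "(\<Omega> ** W) *v (\<chi> p. x p) = 0" by (simp add: matrix_vector_mul_assoc[symmetric])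
  then show ?thesis by (simp add: assms(1) vec_eq_iff)
qed

text \<open>Differentiating \<open>W ** \<Omega> = mat 1\<close> gives
  \<open>A ** \<Omega> y + W y ** B = 0\<close>, with \<open>A\<close> and \<open>B\<close> the
  entrywise derivatives; multiplication by \<open>W y\<close> on the right isolates
  \<open>A\<close>.\<close>

lemma partial_matrix_inverse:
  fixes W \<Omega> :: "real^'n::finite \<Rightarrow> real^'m::finite^'m"
  assumes U: "open U" "y \<in> U"
    and dW: "\<And>i j. (\<lambda>x. W x $ i $ j) differentiable (at y)"
    and dO: "\<And>i j. (\<lambda>x. \<Omega> x $ i $ j) differentiable (at y)"
    and WO: "\<And>x. x \<in> U \<Longrightarrow> W x ** \<Omega> x = mat 1"
  shows "partial p (\<lambda>x. W x $ j $ k) y =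
    - (\<Sum>q\<in>UNIV. \<Sum>r\<in>UNIV. W y $ j $ q * partial p (\<lambda>x. \<Omega> x $ q $ r) y * W y $ r $ k)"
proof -
  define A where "A = (\<chi> j k. partial p (\<lambda>x. W x $ j $ k) y)"
  define B where "B = (\<chi> j k. partial p (\<lambda>x. \<Omega> x $ j $ k) y)"
  have "(\<Sum>q\<in>UNIV. A $ j $ q * \<Omega> y $ q $ r + W y $ j $ q * B $ q $ r) = 0" for j r
  proof -
    have "0 = partial p (\<lambda>x. \<Sum>q\<in>UNIV. W x $ j $ q * \<Omega> x $ q $ r) y"
    proof -
      have "(\<Sum>q\<in>UNIV. W x $ j $ q * \<Omega> x $ q $ r) = (mat 1 :: real^'m^'m) $ j $ r" if "x \<in> U" for x
        by (subst WO[OF that, symmetric]) (simp add: matrix_matrix_mult_def)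
      from partial_cong[OF U this] show ?thesis by simp
    qed
    also have "\<dots> = (\<Sum>q\<in>UNIV. A $ j $ q * \<Omega> y $ q $ r + W y $ j $ q * B $ q $ r)"
      by (simp add: partial_sum partial_mult dW dO A_def B_def)
    finally show ?thesis by simp
  qed
  then have "A ** \<Omega> y + W y ** B = 0"
    by (simp add: vec_eq_iff matrix_matrix_mult_def sum.distrib)
  then have "A ** \<Omega> y = - (W y ** B)" by (simp add: add_eq_0_iff2)
  then have "A ** (\<Omega> y ** W y) = (- (W y ** B)) ** W y" by (simp add: matrix_mul_assoc)
  moreover have "\<Omega> y ** W y = mat 1" using WO[OF U(2)] by (simp add: matrix_left_right_inverse)
  ultimately have "A = (- (W y ** B)) ** W y" by simp
  then have "A $ j $ k = - (\<Sum>r\<in>UNIV. \<Sum>q\<in>UNIV. W y $ j $ q * B $ q $ r * W y $ r $ k)"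
    by (simp add: matrix_matrix_mult_def sum_distrib_right sum_negf)
  then show ?thesis by (subst sum.swap) (simp add: A_def B_def)
qed

text \<open>For antisymmetric \<open>\<Omega>\<close> the cyclic sum is the component formula of the
  exterior derivative of the two-form with coefficients \<open>\<Omega>\<close>.\<close>

definition closed_form_on :: "(real^'n::finite) set \<Rightarrow> (real^'n \<Rightarrow> real^'n^'n) \<Rightarrow> bool" where
  "closed_form_on U \<Omega> \<longleftrightarrow> (\<forall>z\<in>U. \<forall>p q r.
     partial p (\<lambda>x. \<Omega> x $ q $ r) z + partial q (\<lambda>x. \<Omega> x $ r $ p) z
       + partial r (\<lambda>x. \<Omega> x $ p $ q) z = 0)"

text \<open>The Jacobi expression of \<open>W\<close> is the cyclic derivative of
  \<open>\<Omega>\<close> contracted with three copies of the invertible \<open>W\<close>, so either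
  vanishes exactly when the other does.\<close>

lemma jacobi_identity_on_iff_closed_form_on_inverse:
  fixes W \<Omega> :: "real^'n::finite \<Rightarrow> real^'n^'n"
  assumes U: "open U"
    and W: "\<And>i j. smooth_on U (\<lambda>x. W x $ i $ j)"
    and \<Omega>: "\<And>i j. smooth_on U (\<lambda>x. \<Omega> x $ i $ j)"
    and WO: "\<And>x. x \<in> U \<Longrightarrow> W x ** \<Omega> x = mat 1"
    and anti: "\<And>x i j. x \<in> U \<Longrightarrow> W x $ i $ j = - W x $ j $ i"
  shows "jacobi_identity_on U W \<longleftrightarrow> closed_form_on U \<Omega>"
proof -
  let ?dW = "\<lambda>z p j k. partial p (\<lambda>x. W x $ j $ k) z"
  let ?dO = "\<lambda>z p j k. partial p (\<lambda>x. \<Omega> x $ j $ k) z"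
  have jac: "(\<Sum>p\<in>UNIV. W z $ i $ p * ?dW z p j k) + (\<Sum>p\<in>UNIV. W z $ j $ p * ?dW z p k i)
      + (\<Sum>p\<in>UNIV. W z $ k $ p * ?dW z p i j)
    = (\<Sum>p\<in>UNIV. W z $ i $ p * (\<Sum>q\<in>UNIV. W z $ j $ q *
        (\<Sum>r\<in>UNIV. W z $ k $ r * (?dO z p q r + ?dO z q r p + ?dO z r p q))))"
    if z: "z \<in> U" for z i j k
    by (rule jacobiator_eq_contraction[of "\<lambda>i j. W z $ i $ j"], rule anti[OF z],
        rule partial_matrix_inverse[OF U z])
      (auto intro: smooth_on_differentiable[OF _ z] W \<Omega> WO)
  show ?thesis
  proof
    assume J: "jacobi_identity_on U W"
    have "?dO z p q r + ?dO z q r p + ?dO z r p q = 0" if z: "z \<in> U" for z p q r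
    proof -
      have OW: "\<Omega> z ** W z = mat 1" using WO[OF z] by (simp add: matrix_left_right_inverse)
      have "(\<Sum>p\<in>UNIV. W z $ i $ p * (\<Sum>q\<in>UNIV. W z $ j $ q *
          (\<Sum>r\<in>UNIV. W z $ k $ r * (?dO z p q r + ?dO z q r p + ?dO z r p q)))) = 0" for i j k
        using J z unfolding jacobi_identity_on_def jac[OF z, symmetric] by blast
      \<comment> \<open>The three copies of \<open>W\<close> are stripped off one at a time, each
        cancellation freeing one index.\<close>
      from matrix_eq_zero_cancel[OF OW this]
      have "(\<Sum>q\<in>UNIV. W z $ j $ q *
          (\<Sum>r\<in>UNIV. W z $ k $ r * (?dO z p q r + ?dO z q r p + ?dO z r p q))) = 0" for j k .
      from matrix_eq_zero_cancel[OF OW this]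
      have "(\<Sum>r\<in>UNIV. W z $ k $ r * (?dO z p q r + ?dO z q r p + ?dO z r p q)) = 0" for k .
      from matrix_eq_zero_cancel[OF OW this] show ?thesis .
    qed
    then show "closed_form_on U \<Omega>" unfolding closed_form_on_def by blast
  next
    assume "closed_form_on U \<Omega>"
    then have "?dO z p q r + ?dO z q r p + ?dO z r p q = 0" if "z \<in> U" for z p q r
      using that unfolding closed_form_on_def by blast
    then show "jacobi_identity_on U W"
      unfolding jacobi_identity_on_def by (simp add: jac)
  qed
qed

subsection \<open>Pullback of closed forms\<close>

definition jacobian :: "(real^'k::finite \<Rightarrow> real^'n::finite) \<Rightarrow> real^'k \<Rightarrow> real^'k^'n" where
  "jacobian F y = (\<chi> i a. partial a (\<lambda>x. F x $ i) y)"

definition pullback ::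
  "(real^'k::finite \<Rightarrow> real^'n::finite) \<Rightarrow> (real^'n \<Rightarrow> real^'n^'n) \<Rightarrow> real^'k \<Rightarrow> real^'k^'k" where
  "pullback F \<Omega> y = transpose (jacobian F y) ** \<Omega> (F y) ** jacobian F y"

lemma pullback_nth:
  "pullback F \<Omega> y $ a $ b = (\<Sum>i\<in>UNIV. \<Sum>j\<in>UNIV.
     partial a (\<lambda>x. F x $ i) y * \<Omega> (F y) $ i $ j * partial b (\<lambda>x. F x $ j) y)"
  unfolding pullback_def jacobian_def
  by (simp add: matrix_matrix_mult_def transpose_def sum_distrib_right) (rule sum.swap)

lemma smooth_on_pullback:
  fixes F :: "real^'k::finite \<Rightarrow> real^'n::finite"
  assumes "open V" "F ` V \<subseteq> U" "\<And>i. smooth_on V (\<lambda>y. F y $ i)" "\<And>i j. smooth_on U (\<lambda>x. \<Omega> x $ i $ j)"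
  shows "smooth_on V (\<lambda>y. pullback F \<Omega> y $ a $ b)"
  unfolding pullback_nth
  by (intro smooth_on_sum smooth_on_mult smooth_on_partial assms(1,3)
      smooth_on_compose[OF assms(1-3), of "\<lambda>x. \<Omega> x $ _ $ _"] assms(4))

text \<open>In the cyclic sum, the terms with second derivatives of \<open>F\<close> cancel by
  symmetry of these derivatives; the others form the pullback of the vanishing exterior derivative
  of \<open>\<Omega>\<close>.\<close>

lemma closed_form_on_pullback:
  fixes F :: "real^'k::finite \<Rightarrow> real^'n::finite"
  assumes V: "open V" and FV: "F ` V \<subseteq> U" and F: "\<And>i. smooth_on V (\<lambda>y. F y $ i)"
    and \<Omega>: "\<And>i j. smooth_on U (\<lambda>x. \<Omega> x $ i $ j)"
    and anti: "\<And>x i j. x \<in> U \<Longrightarrow> \<Omega> x $ i $ j = - \<Omega> x $ j $ i"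
    and closed: "closed_form_on U \<Omega>"
  shows "closed_form_on V (pullback F \<Omega>)"
  unfolding closed_form_on_def
proof (intro ballI allI)
  fix y a b c assume y: "y \<in> V"
  then have Fy: "F y \<in> U" using FV by blast
  let ?O = "\<lambda>i j. \<Omega> (F y) $ i $ j"
  let ?J = "\<lambda>a i. partial a (\<lambda>x. F x $ i) y"
  let ?H = "\<lambda>c a i. partial c (partial a (\<lambda>x. F x $ i)) y"
  let ?P = "\<lambda>p i j. partial p (\<lambda>x. \<Omega> x $ i $ j) (F y)"
  \<comment> \<open>\<open>T\<close> collects the second derivatives of \<open>F\<close>, and
    \<open>S\<close> the first derivatives of \<open>\<Omega>\<close>.\<close>
  define T where "T c a b = (\<Sum>i\<in>UNIV. \<Sum>j\<in>UNIV. ?H c a i * ?O i j * ?J b j)" for c a b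
  define S where "S c a b = (\<Sum>p\<in>UNIV. \<Sum>i\<in>UNIV. \<Sum>j\<in>UNIV. ?J c p * ?J a i * ?J b j * ?P p i j)" for c a b
  have dF: "(\<lambda>x. F x $ i) differentiable (at y)" for i
    using smooth_on_differentiable[OF F y] .
  have dJ: "partial a (\<lambda>x. F x $ i) differentiable (at y)" for a i
    using smooth_on_differentiable[OF smooth_on_partial[OF F] y] .
  have dO: "(\<lambda>x. \<Omega> x $ i $ j) differentiable (at (F y))" for i j
    using smooth_on_differentiable[OF \<Omega> Fy] .
  have dOF: "(\<lambda>x. \<Omega> (F x) $ i $ j) differentiable (at y)" for i j
    using differentiable_compose_vec[OF dO dF] .
  have pOF: "partial c (\<lambda>x. \<Omega> (F x) $ i $ j) y = (\<Sum>p\<in>UNIV. ?P p i j * ?J c p)" for c i j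
    using partial_compose[OF dO dF] .
  have D: "partial c (\<lambda>x. pullback F \<Omega> x $ a $ b) y = T c a b + S c a b - T c b a" for a b c
  proof -
    have "partial c (\<lambda>x. pullback F \<Omega> x $ a $ b) y = (\<Sum>i\<in>UNIV. \<Sum>j\<in>UNIV.
       (?H c a i * ?O i j + ?J a i * (\<Sum>p\<in>UNIV. ?P p i j * ?J c p)) * ?J b j + ?J a i * ?O i j * ?H c b j)"
      unfolding pullback_nth
      by (simp add: partial_sum partial_mult dJ dOF pOF differentiable_sum differentiable_mult)
    also have "\<dots> = T c a b + (\<Sum>i\<in>UNIV. \<Sum>j\<in>UNIV. \<Sum>p\<in>UNIV. ?J c p * ?J a i * ?J b j * ?P p i j)
        + (\<Sum>i\<in>UNIV. \<Sum>j\<in>UNIV. ?J a i * ?O i j * ?H c b j)"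
      by (simp add: T_def sum.distrib distrib_right distrib_left sum_distrib_left sum_distrib_right mult_ac)
    also have "(\<Sum>i\<in>UNIV. \<Sum>j\<in>UNIV. \<Sum>p\<in>UNIV. ?J c p * ?J a i * ?J b j * ?P p i j) = S c a b"
      unfolding S_def by (rule sum_cycle[symmetric])
    \<comment> \<open>Exchanging \<open>i\<close> and \<open>j\<close> turns this into a
      \<open>T\<close> term; antisymmetry of \<open>\<Omega>\<close> supplies the sign needed for
      the later cancellation.\<close>
    also have "(\<Sum>i\<in>UNIV. \<Sum>j\<in>UNIV. ?J a i * ?O i j * ?H c b j) = - T c b a"
      unfolding T_def
      by (subst sum.swap, subst anti[OF Fy]) (simp add: sum_negf mult_ac)
    finally show ?thesis by simp
  qed
  have "?H c a i = ?H a c i" for a c i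
    by (rule partial_partial_commute[OF V y F])
  then have T: "T c a b = T a c b" for a b c by (simp add: T_def)
  have "S a b c + S b c a + S c a b = 0"
  proof -
    let ?g = "\<lambda>a b c p i j. ?J a p * ?J b i * ?J c j * ?P p i j"
    have 2: "S b c a = (\<Sum>p\<in>UNIV. \<Sum>i\<in>UNIV. \<Sum>j\<in>UNIV. ?g b c a i j p)"
      unfolding S_def by (rule sum_cycle[symmetric])
    have 3: "S c a b = (\<Sum>p\<in>UNIV. \<Sum>i\<in>UNIV. \<Sum>j\<in>UNIV. ?g c a b j p i)"
      unfolding S_def using sum_cycle[of "\<lambda>p i j. ?g c a b j p i"] by simp
    have "S a b c + S b c a + S c a b = (\<Sum>p\<in>UNIV. \<Sum>i\<in>UNIV. \<Sum>j\<in>UNIV.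
        ?J a p * ?J b i * ?J c j * (?P p i j + ?P i j p + ?P j p i))"
      unfolding 2 3 S_def[of a b c] by (simp add: sum.distrib[symmetric] algebra_simps)
    also have "\<dots> = 0" using closed Fy unfolding closed_form_on_def by simp
    finally show ?thesis .
  qed
  then show "partial a (\<lambda>x. pullback F \<Omega> x $ b $ c) y + partial b (\<lambda>x. pullback F \<Omega> x $ c $ a) y
     + partial c (\<lambda>x. pullback F \<Omega> x $ a $ b) y = 0"
    unfolding D using T[of a b c] T[of b c a] T[of c a b] by simp
qed

subsection \<open>The bracket of a Poisson tensor\<close>

text \<open>Only the Jacobi identity for functions needs work: Hessian terms cancel in pairs, and
  what remains is the Jacobi identity of \<open>W\<close> contracted with three gradients.\<close>

lemma poisson_bracket_on_bracket:
  fixes W :: "real^'n::finite \<Rightarrow> real^'n^'n"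
  assumes U: "open U" and W: "poisson_tensor_on U W"
  shows "poisson_bracket_on U (bracket W)"
proof -
  have Ws: "smooth_on U (\<lambda>z. W z $ i $ j)" for i j using W by (simp add: poisson_tensor_on_def)
  have anti: "W z $ i $ j = - W z $ j $ i" if "z \<in> U" for z i j
    using W that unfolding poisson_tensor_on_def by blast
  have smooth: "smooth_on U (bracket W A B)" if "smooth_on U A" "smooth_on U B" for A B
    unfolding bracket_def[abs_def] by (intro smooth_on_sum smooth_on_mult smooth_on_partial Ws U that)
  have antisym: "bracket W A B z = - bracket W B A z" if z: "z \<in> U" for A B z
    unfolding bracket_def by (subst sum.swap, subst anti[OF z]) (simp add: sum_negf mult_ac)
  have lin: "bracket W A (\<lambda>x. s * B x + t * C x) z = s * bracket W A B z + t * bracket W A C z"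
    if "smooth_on U B" "smooth_on U C" "z \<in> U" for A B C z s t
  proof -
    have "partial j (\<lambda>x. s * B x + t * C x) z = s * partial j B z + t * partial j C z" for j
      using that by (simp add: partial_add partial_cmult smooth_on_differentiable)
    then show ?thesis by (simp add: bracket_def sum.distrib sum_distrib_left algebra_simps)
  qed
  have leibniz: "bracket W A (\<lambda>x. B x * C x) z = bracket W A B z * C z + B z * bracket W A C z"
    if "smooth_on U B" "smooth_on U C" "z \<in> U" for A B C z
    using that by (simp add: bracket_def partial_mult smooth_on_differentiable sum.distrib
        sum_distrib_left sum_distrib_right algebra_simps)
  have jacobi: "bracket W A (bracket W B C) z + bracket W B (bracket W C A) z + bracket W C (bracket W A B) z = 0"
    if A: "smooth_on U A" and B: "smooth_on U B" and C: "smooth_on U C" and z: "z \<in> U" for A B C z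
  proof -
    \<comment> \<open>\<open>X A\<close> is the vector field of the derivation {A, .} at
      \<open>z\<close>, \<open>H B A C\<close> is the Hessian of \<open>B\<close> on
      \<open>X A\<close> and \<open>X C\<close>, and \<open>K\<close> gathers the derivatives of
      \<open>W\<close>.\<close>
    define X where "X A p = (\<Sum>i\<in>UNIV. partial i A z * W z $ i $ p)" for A p
    define H where "H B A C = (\<Sum>p\<in>UNIV. \<Sum>j\<in>UNIV. X A p * partial p (partial j B) z * X C j)" for A B C
    let ?dW = "\<lambda>p j k. partial p (\<lambda>x. W x $ j $ k) z"
    define K where "K A B C = (\<Sum>i\<in>UNIV. \<Sum>j\<in>UNIV. \<Sum>k\<in>UNIV. partial i A z * partial j B z * partial k C z *
        (\<Sum>p\<in>UNIV. W z $ i $ p * ?dW p j k))" for A B C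
    have X': "(\<Sum>k\<in>UNIV. W z $ j $ k * partial k C z) = - X C j" for C j
      unfolding X_def by (subst anti[OF z]) (simp add: sum_negf mult_ac)
    have Hsym: "H B A C = H B C A" if "smooth_on U B" for A B C
      unfolding H_def
      by (subst sum.swap, subst partial_partial_commute[OF U z that]) (simp add: mult_ac)
    \<comment> \<open>The product rule differentiates the gradient of \<open>B\<close>, the tensor
      \<open>W\<close> and the gradient of \<open>C\<close> in turn. The minus sign arises since
      \<open>W\<close> is contracted on its second index, see \<open>X'\<close>.\<close>
    have main: "bracket W A (bracket W B C) z = - H B A C + H C A B + K A B C"
      if B: "smooth_on U B" and C: "smooth_on U C" for A B C
    proof -
      have d: "partial j B differentiable (at z)" "partial j C differentiable (at z)"
        "(\<lambda>x. W x $ j $ k) differentiable (at z)" for j k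
        using B C Ws z by (blast intro: smooth_on_differentiable smooth_on_partial)+
      have "partial p (bracket W B C) z = (\<Sum>j\<in>UNIV. partial p (partial j B) z * (\<Sum>k\<in>UNIV. W z $ j $ k * partial k C z))
          + (\<Sum>j\<in>UNIV. \<Sum>k\<in>UNIV. partial j B z * partial k C z * ?dW p j k)
          + (\<Sum>j\<in>UNIV. \<Sum>k\<in>UNIV. partial j B z * W z $ j $ k * partial p (partial k C) z)" for p
        unfolding bracket_def[abs_def]
        by (simp add: partial_sum partial_mult d differentiable_sum differentiable_mult sum.distrib
            distrib_right distrib_left sum_distrib_left mult_ac)
      also have "(\<Sum>j\<in>UNIV. \<Sum>k\<in>UNIV. partial j B z * W z $ j $ k * partial p (partial k C) z)
         = (\<Sum>k\<in>UNIV. X B k * partial p (partial k C) z)" for p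
        by (subst sum.swap) (simp add: X_def sum_distrib_right)
      finally have D: "partial p (bracket W B C) z = (\<Sum>j\<in>UNIV. partial p (partial j B) z * - X C j)
          + (\<Sum>j\<in>UNIV. \<Sum>k\<in>UNIV. partial j B z * partial k C z * ?dW p j k)
          + (\<Sum>k\<in>UNIV. X B k * partial p (partial k C) z)" for p
        unfolding X' .
      have "bracket W A (bracket W B C) z = (\<Sum>p\<in>UNIV. X A p * partial p (bracket W B C) z)"
        unfolding bracket_def[of W A] X_def by (subst sum.swap) (simp add: sum_distrib_right)
      also have "\<dots> = - H B A C + (\<Sum>p\<in>UNIV. X A p * (\<Sum>j\<in>UNIV. \<Sum>k\<in>UNIV. partial j B z * partial k C z * ?dW p j k)) + H C A B"
        unfolding D H_def
        by (simp add: distrib_left right_diff_distrib sum.distrib sum_subtractf sum_distrib_left sum_negf mult_ac)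
      also have "(\<Sum>p\<in>UNIV. X A p * (\<Sum>j\<in>UNIV. \<Sum>k\<in>UNIV. partial j B z * partial k C z * ?dW p j k))
         = (\<Sum>p\<in>UNIV. \<Sum>i\<in>UNIV. partial i A z * W z $ i $ p * (\<Sum>j\<in>UNIV. \<Sum>k\<in>UNIV. partial j B z * partial k C z * ?dW p j k))"
        unfolding X_def by (simp add: sum_distrib_right)
      also have "\<dots> = (\<Sum>i\<in>UNIV. \<Sum>p\<in>UNIV. \<Sum>j\<in>UNIV. \<Sum>k\<in>UNIV. partial i A z * partial j B z * partial k C z * (W z $ i $ p * ?dW p j k))"
        by (subst sum.swap) (simp add: sum_distrib_left mult_ac)
      also have "\<dots> = (\<Sum>i\<in>UNIV. \<Sum>j\<in>UNIV. \<Sum>p\<in>UNIV. \<Sum>k\<in>UNIV. partial i A z * partial j B z * partial k C z * (W z $ i $ p * ?dW p j k))"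
        by (intro sum.cong refl sum.swap)
      also have "\<dots> = (\<Sum>i\<in>UNIV. \<Sum>j\<in>UNIV. \<Sum>k\<in>UNIV. \<Sum>p\<in>UNIV. partial i A z * partial j B z * partial k C z * (W z $ i $ p * ?dW p j k))"
        by (intro sum.cong refl sum.swap)
      also have "\<dots> = K A B C" by (simp add: K_def sum_distrib_left)
      finally show ?thesis by simp
    qed
    have "K A B C + K B C A + K C A B = 0"
    proof -
      let ?j = "\<lambda>i j k. (\<Sum>p\<in>UNIV. W z $ i $ p * ?dW p j k)"
      let ?g = "\<lambda>A B C i j k. partial i A z * partial j B z * partial k C z * ?j i j k"
      have 2: "K B C A = (\<Sum>p\<in>UNIV. \<Sum>i\<in>UNIV. \<Sum>j\<in>UNIV. ?g B C A i j p)"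
        unfolding K_def by (rule sum_cycle[symmetric])
      have 3: "K C A B = (\<Sum>p\<in>UNIV. \<Sum>i\<in>UNIV. \<Sum>j\<in>UNIV. ?g C A B j p i)"
        unfolding K_def using sum_cycle[of "\<lambda>p i j. ?g C A B j p i"] by simp
      let ?t = "\<lambda>i j k. partial i A z * partial j B z * partial k C z"
      have "K A B C + K B C A + K C A B = (\<Sum>i\<in>UNIV. \<Sum>j\<in>UNIV. \<Sum>k\<in>UNIV. ?t i j k * ?j i j k)
          + (\<Sum>i\<in>UNIV. \<Sum>j\<in>UNIV. \<Sum>k\<in>UNIV. ?t i j k * ?j j k i)
          + (\<Sum>i\<in>UNIV. \<Sum>j\<in>UNIV. \<Sum>k\<in>UNIV. ?t i j k * ?j k i j)"
        unfolding 2 3 K_def[of A B C] by (simp only: mult_ac)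
      also have "\<dots> = (\<Sum>i\<in>UNIV. \<Sum>j\<in>UNIV. \<Sum>k\<in>UNIV. ?t i j k * (?j i j k + ?j j k i + ?j k i j))"
        by (simp only: sum.distrib distrib_left)
      also have "\<dots> = 0"
      proof -
        have "?j i j k + ?j j k i + ?j k i j = 0" for i j k
          using W z unfolding poisson_tensor_on_def jacobi_identity_on_def by blast
        then show ?thesis by simp
      qed
      finally show ?thesis .
    qed
    then show ?thesis
      using main[OF B C, of A] main[OF C A, of B] main[OF A B, of C]
        Hsym[OF A, of B C] Hsym[OF B, of C A] Hsym[OF C, of A B] by linarith
  qed
  show ?thesis unfolding poisson_bracket_on_def
    using smooth antisym lin leibniz jacobi by blast
qed

subsection \<open>The Dirac matrix\<close>

lemma matrix_diff_rdistrib: "(A - B :: real^'n::finite^'m::finite) ** C = A ** C - B ** C"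
  by (simp add: vec_eq_iff matrix_matrix_mult_def left_diff_distrib sum_subtractf)

lemma transpose_eq_uminus_iff:
  "transpose A = - A \<longleftrightarrow> (\<forall>i j. A $ i $ j = - A $ j $ i)" for A :: "real^'n::finite^'n"
  by (simp add: vec_eq_iff transpose_def) metis

text \<open>Transposing \<open>A ** B = mat 1\<close> makes \<open>- transpose B\<close> a left
  inverse of \<open>A\<close>, which must equal the right inverse \<open>B\<close>.\<close>

lemma inverse_antisymmetric:
  fixes A B :: "real^'n::finite^'n"
  assumes "A ** B = mat 1" "transpose A = - A"
  shows "transpose B = - B"
proof -
  have BA: "B ** A = mat 1" using assms(1) by (simp add: matrix_left_right_inverse)
  have "transpose B ** transpose A = mat 1"
    using arg_cong[OF assms(1), of transpose] by (simp add: matrix_transpose_mul)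
  then have "(- transpose B) ** A = mat 1"
    by (simp add: assms(2) vec_eq_iff matrix_matrix_mult_def sum_negf)
  then have "- transpose B = - transpose B ** (A ** B)" "(- transpose B) ** A ** B = B"
    using assms(1) by simp_all
  then show ?thesis by (simp add: matrix_mul_assoc minus_equation_iff)
qed

text \<open>With \<open>D = w - w P\<^sup>T (P w P\<^sup>T)\<^sup>-\<^sup>1 P w\<close> one has \<open>D P\<^sup>T = 0\<close>, so the rows of \<open>D\<close> are tangent to the
  constraint surface, on which \<open>J E\<close> is the identity; hence \<open>D E\<^sup>T J\<^sup>T = D\<close> and
  \<open>E D \<Omega> J = E J = 1\<close>.\<close>
lemma dirac_matrix_algebra:
  fixes w \<Omega> :: "real^'n::finite^'n" and P :: "real^'n^'m::finite" and J :: "real^'k::finite^'n"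
    and E :: "real^'n^'k" and R :: "real^'m^'m"
  assumes wO: "w ** \<Omega> = mat 1" and R: "(P ** w ** transpose P) ** R = mat 1"
    and PJ: "P ** J = 0" and EJ: "E ** J = mat 1"
    and ker: "\<And>v. P *v v = 0 \<Longrightarrow> E *v v = 0 \<Longrightarrow> v = 0"
  shows "(E ** (w - w ** transpose P ** R ** P ** w) ** transpose E) ** (transpose J ** \<Omega> ** J) = mat 1"
proof -
  define D where "D = w - w ** transpose P ** R ** P ** w"
  have RD: "R ** (P ** w ** transpose P) = mat 1" using R by (simp add: matrix_left_right_inverse)
  have "D ** transpose P = w ** transpose P - w ** transpose P ** (R ** (P ** w ** transpose P))"
    by (simp add: D_def matrix_diff_rdistrib matrix_mul_assoc)
  then have "D ** transpose P = 0" by (simp add: RD)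
  then have "transpose (D ** transpose P) = 0" by (simp add: transpose_def vec_eq_iff)
  then have PD: "P ** transpose D = 0" by (simp add: matrix_transpose_mul)
  \<comment> \<open>For \<open>u\<close> in the range of \<open>transpose D\<close>, both
    \<open>P\<close> and \<open>E\<close> annihilate J E u - u, so \<open>ker\<close> forces it to
    vanish.\<close>
  have "J ** E ** transpose D = transpose D"
  proof (rule iffD2[OF matrix_eq], rule allI)
    fix x
    let ?u = "transpose D *v x"
    have Pu: "P *v ?u = 0" by (simp only: matrix_vector_mul_assoc PD matrix_vector_mult_0)
    have "P *v (J *v v) = 0" for v
      by (simp only: matrix_vector_mul_assoc PJ matrix_vector_mult_0)
    then have "P *v (J *v (E *v ?u) - ?u) = 0"
      by (simp only: matrix_vector_mult_diff_distrib Pu diff_self)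
    moreover have "E *v (J *v v) = v" for v
      by (simp only: matrix_vector_mul_assoc EJ matrix_vector_mul_lid)
    then have "E *v (J *v (E *v ?u) - ?u) = 0"
      by (simp only: matrix_vector_mult_diff_distrib diff_self)
    ultimately have "J *v (E *v ?u) = ?u" using ker by fastforce
    then show "(J ** E ** transpose D) *v x = ?u" by (simp only: matrix_vector_mul_assoc matrix_mul_assoc)
  qed
  then have "transpose (J ** E ** transpose D) = transpose (transpose D)" by (simp only:)
  then have DEJ: "D ** transpose E ** transpose J = D"
    by (simp add: matrix_transpose_mul matrix_mul_assoc)
  \<comment> \<open>Since \<open>w ** \<Omega>\<close> is the identity, the correction term ends in
    \<open>P ** J\<close>, which is zero.\<close>
  have "D ** \<Omega> ** J = w ** \<Omega> ** J - w ** transpose P ** R ** P ** (w ** \<Omega>) ** J"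
    by (simp add: D_def matrix_diff_rdistrib matrix_mul_assoc)
  also have "\<dots> = J - w ** transpose P ** R ** (P ** J)" by (simp add: wO matrix_mul_assoc)
  also have "\<dots> = J" by (simp only: PJ) (simp add: vec_eq_iff matrix_matrix_mult_def)
  finally have DOJ: "D ** \<Omega> ** J = J" .
  have "(E ** D ** transpose E) ** (transpose J ** \<Omega> ** J)
      = E ** (D ** transpose E ** transpose J) ** \<Omega> ** J"
    by (simp only: matrix_mul_assoc)
  also have "\<dots> = E ** (D ** \<Omega> ** J)" by (simp only: DEJ matrix_mul_assoc)
  also have "\<dots> = mat 1" by (simp only: DOJ EJ)
  finally show ?thesis by (simp only: D_def)
qed

text \<open>This is the \<open>E\<close> of \<open>dirac_matrix_algebra\<close>. As a matrix it
  turns the selection of the block with indices \<open>Inr a\<close>, \<open>Inr b\<close> into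
  multiplication on both sides.\<close>

definition free_projection :: "real^('m::finite + 'k::finite)^'k" where
  "free_projection = (\<chi> a i. if i = Inr a then 1 else 0)"

lemma free_projection_mult_nth [simp]:
  "(free_projection ** (A :: real^'n::finite^('m::finite + 'k::finite))) $ a $ j = A $ Inr a $ j"
  by (simp add: matrix_matrix_mult_def free_projection_def if_distrib[of "\<lambda>x. x * _"] cong: if_cong)

lemma free_projection_vector_nth [simp]: "(free_projection *v v) $ a = v $ Inr a"
  by (simp add: matrix_vector_mult_def free_projection_def if_distrib[of "\<lambda>x. x * _"] cong: if_cong)

lemma mult_transpose_free_projection_nth [simp]:
  "((A :: real^('m::finite + 'k::finite)^'n::finite) ** transpose free_projection) $ i $ b = A $ i $ Inr b"
  by (simp add: matrix_matrix_mult_def free_projection_def transpose_def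
      if_distrib[of "\<lambda>x. _ * x"] cong: if_cong)

section \<open>Matrix forms of the brackets with constraints and coordinates\<close>

lemma constraint_matrix_eq:
  "constraint_matrix \<omega> \<Phi> z = constraint_jacobian \<Phi> z ** \<omega> z ** transpose (constraint_jacobian \<Phi> z)"
  by (simp add: vec_eq_iff constraint_matrix_def bracket_def constraint_jacobian_def
      matrix_matrix_mult_def transpose_def sum_distrib_right) (intro allI sum.swap)

lemma bracket_coordinate_left: "bracket \<omega> (\<lambda>x. x $ i) B z = (\<Sum>j\<in>UNIV. \<omega> z $ i $ j * partial j B z)"
  unfolding bracket_def partial_coordinate
  by (subst sum.swap) (simp add: if_distrib[of "\<lambda>x. x * _"] cong: if_cong)

lemma bracket_coordinate_right: "bracket \<omega> A (\<lambda>x. x $ j) z = (\<Sum>i\<in>UNIV. partial i A z * \<omega> z $ i $ j)"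
  unfolding bracket_def partial_coordinate
  by (simp add: if_distrib[of "\<lambda>x. _ * x"] cong: if_cong)

text \<open>Brackets of coordinates with constraints are entries of
  \<open>\<omega> z ** transpose (P z)\<close> and \<open>P z ** \<omega> z\<close>. This exhibits
  the Dirac matrix as a block of the matrix \<open>D\<close> treated in
  \<open>dirac_matrix_algebra\<close>.\<close>

lemma dirac_matrix_eq:
  fixes \<Phi> :: "'m::finite \<Rightarrow> real^('m + 'k::finite) \<Rightarrow> real"
  defines "P \<equiv> constraint_jacobian \<Phi>"
  shows "dirac_matrix \<omega> \<Phi> z = free_projection ** (\<omega> z - \<omega> z ** transpose (P z) **
    matrix_inv (constraint_matrix \<omega> \<Phi> z) ** P z ** \<omega> z) ** transpose free_projection"
proof -
  let ?R = "matrix_inv (constraint_matrix \<omega> \<Phi> z)"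
  have "bracket \<omega> (\<lambda>x. x $ Inr a) (\<Phi> \<alpha>) z = (\<omega> z ** transpose (P z)) $ Inr a $ \<alpha>" for a \<alpha>
    by (simp add: bracket_coordinate_left matrix_matrix_mult_def transpose_def P_def constraint_jacobian_def)
  moreover have "bracket \<omega> (\<Phi> \<beta>) (\<lambda>x. x $ Inr b) z = (P z ** \<omega> z) $ \<beta> $ Inr b" for b \<beta>
    by (simp add: bracket_coordinate_right matrix_matrix_mult_def P_def constraint_jacobian_def)
  moreover have "bracket \<omega> (\<lambda>x. x $ Inr a) (\<lambda>x. x $ Inr b) z = \<omega> z $ Inr a $ Inr b" for a b
    by (simp add: bracket_coordinate_left partial_coordinate if_distrib[of "\<lambda>x. _ * x"] cong: if_cong)
  moreover have "(A ** ?R ** B) $ i $ j = (\<Sum>\<alpha>\<in>UNIV. \<Sum>\<beta>\<in>UNIV. A $ i $ \<alpha> * ?R $ \<alpha> $ \<beta> * B $ \<beta> $ j)"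
    for A :: "real^'m^('m + 'k)" and B :: "real^('m + 'k)^'m" and i j
    by (simp add: matrix_matrix_mult_def sum_distrib_right) (rule sum.swap)
  ultimately show ?thesis
    unfolding matrix_mul_assoc[of _ "P z" "\<omega> z", symmetric]
    by (simp add: vec_eq_iff dirac_matrix_def)
qed

text \<open>If the free components of \<open>v\<close> vanish, the constraint Jacobian acts on
  \<open>v\<close> through its invertible left block alone. This provides the assumption
  \<open>ker\<close> of \<open>dirac_matrix_algebra\<close>.\<close>

lemma constraint_kernel_trivial:
  fixes \<Phi> :: "'m::finite \<Rightarrow> real^('m + 'k::finite) \<Rightarrow> real"
  assumes det: "det (constraint_jacobian_left \<Phi> z) \<noteq> 0"
    and Pv: "constraint_jacobian \<Phi> z *v v = 0" and Ev: "free_projection *v v = 0"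
  shows "v = 0"
proof -
  have r: "v $ Inr a = 0" for a
    using Ev free_projection_vector_nth[of v a] by simp
  let ?L = "constraint_jacobian_left \<Phi> z" and ?u = "\<chi> \<alpha>. v $ Inl \<alpha>"
  have "(\<Sum>i\<in>UNIV. h i) = (\<Sum>\<alpha>\<in>UNIV. h (Inl \<alpha>)) + (\<Sum>a\<in>UNIV. h (Inr a))" for h :: "'m + 'k \<Rightarrow> real"
    by (simp add: UNIV_Plus_UNIV[symmetric] sum.Plus del: UNIV_Plus_UNIV)
  then have "?L *v ?u = constraint_jacobian \<Phi> z *v v"
    by (simp add: vec_eq_iff matrix_vector_mult_def constraint_jacobian_left_def
        constraint_jacobian_def r)
  then have "?L *v ?u = 0" using Pv by simp
  then have "matrix_inv ?L *v (?L *v ?u) = 0" by simp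
  then have "?u = 0" by (simp only: matrix_vector_mul_assoc matrix_inv_right_left(2)[OF det] matrix_vector_mul_lid)
  then have l: "v $ Inl \<alpha> = 0" for \<alpha> by (simp add: vec_eq_iff)
  have "v $ i = 0" for i by (cases i) (simp_all add: l r)
  then show ?thesis by (simp add: vec_eq_iff)
qed

section \<open>The Dirac structure as the inverse of a pulled-back closed form\<close>

theorem mainTheorem2:
  fixes M :: "(real^('m::finite + 'k::finite)) set"
    and \<omega> :: "real^('m + 'k) \<Rightarrow> real^('m + 'k)^('m + 'k)"
    and \<Phi> :: "'m \<Rightarrow> real^('m + 'k) \<Rightarrow> real"
    and V :: "(real^'k) set"
    and f :: "real^'k \<Rightarrow> real^'m"
  assumes "open M"
    and "poisson_tensor_on M \<omega>"
    and "nondegenerate_on M \<omega>"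
    and "\<And>\<alpha>. smooth_on M (\<Phi> \<alpha>)"
    and "\<And>z. z \<in> constraint_set M \<Phi> \<Longrightarrow> rank (constraint_jacobian \<Phi> z) = CARD('m)"
    and "\<And>z. z \<in> constraint_set M \<Phi> \<Longrightarrow> det (constraint_jacobian_left \<Phi> z) \<noteq> 0"
    and "\<And>z. z \<in> constraint_set M \<Phi> \<Longrightarrow> det (constraint_matrix \<omega> \<Phi> z) \<noteq> 0"
    and "open V"
    and "\<And>\<alpha>. smooth_on V (\<lambda>y. f y $ \<alpha>)"
    and "constraint_set M \<Phi> = (\<lambda>y. join (f y) y) ` V"
  shows "jacobi_identity_on V (restricted_dirac_matrix \<omega> \<Phi> f)
    \<and> poisson_tensor_on V (restricted_dirac_matrix \<omega> \<Phi> f)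
    \<and> nondegenerate_on V (restricted_dirac_matrix \<omega> \<Phi> f)
    \<and> poisson_bracket_on V (bracket (restricted_dirac_matrix \<omega> \<Phi> f))"
proof -
  define F where "F y = join (f y) y" for y
  define \<Omega> where "\<Omega> z = matrix_inv (\<omega> z)" for z
  let ?W = "restricted_dirac_matrix \<omega> \<Phi> f" and ?O = "pullback F \<Omega>"
  have on_N: "F y \<in> constraint_set M \<Phi>" if "y \<in> V" for y
    using assms(10) that by (auto simp: F_def)
  then have \<Phi>F: "\<Phi> \<alpha> (F y) = 0" if "y \<in> V" for y \<alpha>
    using that by (simp add: constraint_set_def)
  have FV: "F ` V \<subseteq> M" using on_N by (auto simp: constraint_set_def)
  have F: "smooth_on V (\<lambda>y. F y $ i)" for i
    using assms(9) by (cases i) (simp_all add: F_def join_def smooth_on_coordinate)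
  have \<omega>: "smooth_on M (\<lambda>z. \<omega> z $ i $ j)" for i j
    using assms(2) by (simp add: poisson_tensor_on_def)
  have anti_\<omega>: "\<omega> z $ i $ j = - \<omega> z $ j $ i" if "z \<in> M" for z i j
    using assms(2) that unfolding poisson_tensor_on_def by blast
  have det_\<omega>: "det (\<omega> z) \<noteq> 0" if "z \<in> M" for z
    using assms(3) that unfolding nondegenerate_on_def by blast
  have \<omega>\<Omega>: "\<omega> z ** \<Omega> z = mat 1" if "z \<in> M" for z
    unfolding \<Omega>_def by (rule matrix_inv_right_left(1)[OF det_\<omega>[OF that]])
  have \<Omega>: "smooth_on M (\<lambda>z. \<Omega> z $ i $ j)" for i j
    unfolding \<Omega>_def by (rule smooth_on_matrix_inv[OF assms(1) \<omega> det_\<omega>])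
  have anti_\<Omega>: "transpose (\<Omega> z) = - \<Omega> z" if "z \<in> M" for z
    using inverse_antisymmetric[OF \<omega>\<Omega>[OF that]] anti_\<omega>[OF that]
    unfolding transpose_eq_uminus_iff by blast
  \<comment> \<open>The equivalence is used here on \<open>M\<close> to pass from the Jacobi
    identity to closedness; at the end it is used on \<open>V\<close> in the opposite
    direction.\<close>
  have closed_\<Omega>: "closed_form_on M \<Omega>"
    using jacobi_identity_on_iff_closed_form_on_inverse[OF assms(1) \<omega> \<Omega> \<omega>\<Omega> anti_\<omega>] assms(2)
    by (simp add: poisson_tensor_on_def)
  have anti_\<Omega>': "\<Omega> z $ i $ j = - \<Omega> z $ j $ i" if "z \<in> M" for z i j
    using anti_\<Omega>[OF that] unfolding transpose_eq_uminus_iff by blast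
  have O: "smooth_on V (\<lambda>y. ?O y $ a $ b)" for a b
    by (rule smooth_on_pullback[OF assms(8) FV F \<Omega>])
  have closed_O: "closed_form_on V ?O"
    by (rule closed_form_on_pullback[OF assms(8) FV F \<Omega> anti_\<Omega>' closed_\<Omega>])
  have WO: "?W y ** ?O y = mat 1" if y: "y \<in> V" for y
  proof -
    have z: "F y \<in> M" using FV y by blast
    \<comment> \<open>Differentiating the constraints along the parametrization, where they vanish
      identically, shows that the columns of the Jacobian of \<open>F\<close> are tangent to the
      surface.\<close>
    have "(\<Sum>i\<in>UNIV. partial i (\<Phi> \<alpha>) (F y) * partial a (\<lambda>x. F x $ i) y) = 0" for \<alpha> a
    proof -
      have "(\<Sum>i\<in>UNIV. partial i (\<Phi> \<alpha>) (F y) * partial a (\<lambda>x. F x $ i) y) = partial a (\<lambda>x. \<Phi> \<alpha> (F x)) y"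
        using smooth_on_differentiable[OF assms(4) z] smooth_on_differentiable[OF F y]
        by (rule partial_compose[symmetric])
      also have "\<dots> = partial a (\<lambda>x. 0) y" by (rule partial_cong[OF assms(8) y]) (rule \<Phi>F)
      finally show ?thesis by simp
    qed
    then have PJ: "constraint_jacobian \<Phi> (F y) ** jacobian F y = 0"
      by (simp add: vec_eq_iff matrix_matrix_mult_def constraint_jacobian_def jacobian_def)
    \<comment> \<open>The free components of \<open>F y\<close> are \<open>y\<close> itself, so
      their block of the Jacobian is the identity.\<close>
    have EJ: "free_projection ** jacobian F y = mat 1"
      by (simp add: vec_eq_iff jacobian_def F_def join_def partial_coordinate mat_def eq_commute)
    have "(constraint_jacobian \<Phi> (F y) ** \<omega> (F y) ** transpose (constraint_jacobian \<Phi> (F y)))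
        ** matrix_inv (constraint_matrix \<omega> \<Phi> (F y)) = mat 1"
      unfolding constraint_matrix_eq[symmetric]
      by (rule matrix_inv_right_left(1)[OF assms(7)[OF on_N[OF y]]])
    from dirac_matrix_algebra[OF \<omega>\<Omega>[OF z] this PJ EJ
        constraint_kernel_trivial[OF assms(6)[OF on_N[OF y]]]]
    show ?thesis
      by (simp add: restricted_dirac_matrix_def dirac_matrix_eq pullback_def F_def)
  qed
  have OW: "?O y ** ?W y = mat 1" if "y \<in> V" for y
    using WO[OF that] by (simp add: matrix_left_right_inverse)
  have det_O: "det (?O y) \<noteq> 0" if "y \<in> V" for y
    using OW[OF that] invertible_right_inverse invertible_det_nz by blast
  \<comment> \<open>Identifying \<open>?W\<close> with the chosen inverse of the smooth matrix
    \<open>?O\<close> transfers smoothness to it.\<close>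
  have W_eq: "matrix_inv (?O y) = ?W y" if "y \<in> V" for y
  proof -
    have "matrix_inv (?O y) = matrix_inv (?O y) ** (?O y ** ?W y)" by (simp add: OW that)
    then show ?thesis by (simp add: matrix_mul_assoc matrix_inv_right_left det_O that)
  qed
  have W: "smooth_on V (\<lambda>y. ?W y $ a $ b)" for a b
    by (rule smooth_on_cong[OF assms(8) _ smooth_on_matrix_inv[OF assms(8) O det_O]]) (simp add: W_eq)
  have anti_W: "?W y $ a $ b = - ?W y $ b $ a" if "y \<in> V" for y a b
  proof -
    have z: "F y \<in> M" using FV that by blast
    have "?O y $ a $ b = - ?O y $ b $ a" for a b
      unfolding pullback_nth by (subst sum.swap, subst anti_\<Omega>'[OF z]) (simp add: sum_negf mult_ac)
    with inverse_antisymmetric[OF OW[OF that]] show ?thesis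
      unfolding transpose_eq_uminus_iff by blast
  qed
  have "jacobi_identity_on V ?W"
    using jacobi_identity_on_iff_closed_form_on_inverse[OF assms(8) W O WO anti_W] closed_O by blast
  moreover from this have P: "poisson_tensor_on V ?W"
    unfolding poisson_tensor_on_def using W anti_W by blast
  moreover have "nondegenerate_on V ?W"
    unfolding nondegenerate_on_def using WO invertible_right_inverse invertible_det_nz by blast
  ultimately show ?thesis using poisson_bracket_on_bracket[OF assms(8) P] by blast
qed

end
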